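(* Let $n\ge 1$ be an integer, $h=1/(n+1)$, and $0<\vartheta<1$. Let $A_h\in\mathbb{R}^{(n+1)\times(n+1)}$ be the one-dimensional Coco--Russo matrix with parameters $n,h,\vartheta$ (defined in the context). Then $$\|A_h^{-1}\|_1=\frac{h+1}{2h\,(h(\vartheta-1)+1)},$$ $$\|A_h^{-1}\|_\infty=\frac{2-h(\vartheta-1)(1-h)}{2\,(h(\vartheta-1)+1)},$$ and $$\|A_h^{-1}\|_2\le\frac{1}{2\,(h(\vartheta-1)+1)}\sqrt{\frac{2}{h}+2+(h^2-1)(\vartheta-1)}.$$
   Context: For $p\in[1,\infty]$, $\|\cdot\|_p$ denotes the matrix norm induced by the vector $p$-norm (so $\|\cdot\|_1$ is the maximum absolute column sum, $\|\cdot\|_\infty$ the maximum absolute row sum, and $\|\cdot\|_2$ the spectral norm). The one-dimensional Coco--Russo matrix is the coefficient matrix of a finite difference discretization of $-u''=f$ on an interval $(a,b)$ with Dirichlet boundary conditions, with a uniform grid of step $h$ whose leftmost node $x_0<a<x_1$ is a ghost point, $\vartheta=(x_1-a)/h$, and $x_{n+1}=b$. Explicitly, indexing rows and columns by $0,1,\dots,n$: - row $0$ has entries $(A_h)_{0,0}=\vartheta$, $(A_h)_{0,1}=1-\vartheta$, and zeros elsewhere; - for $1\le i\le n$, row $i$ has entries $(A_h)_{i,i-1}=-1/h^2$, $(A_h)_{i,i}=2/h^2$, $(A_h)_{i,i+1}=-1/h^2$ (the last one only if $i\le n-1$), and zeros elsewhere. *)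

theory Defs
  imports
    Complex_Main
    "HOL-Library.Extended_Real"
    "Jordan_Normal_Form.Gauss_Jordan_Elimination"
begin

(* Intended for 1 \<le> p \<le> \<infinity>. The 0 inserted under Max only matters for the
   0-dimensional vector. *)
definition vec_pnorm :: "ereal \<Rightarrow> real vec \<Rightarrow> real" where
  "vec_pnorm p v =
     (if p = \<infinity> then Max (insert 0 ((\<lambda>i. \<bar>v $ i\<bar>) ` {..<dim_vec v}))
      else (\<Sum>i<dim_vec v. \<bar>v $ i\<bar> powr real_of_ereal p) powr (1 / real_of_ereal p))"

(* As in onorm, x = 0 is included harmlessly: its quotient is 0 / 0 = 0. *)
definition mat_pnorm :: "ereal \<Rightarrow> real mat \<Rightarrow> real" where
  "mat_pnorm p A =
     (SUP x \<in> carrier_vec (dim_col A). vec_pnorm p (A *\<^sub>v x) / vec_pnorm p x)"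

definition coco_russo :: "nat \<Rightarrow> real \<Rightarrow> real \<Rightarrow> real mat" where
  "coco_russo n h \<theta> = mat (n + 1) (n + 1) (\<lambda>(i, j).
     if i = 0 then (if j = 0 then \<theta> else if j = 1 then 1 - \<theta> else 0)
     else if j = i then 2 / h\<^sup>2
     else if j + 1 = i \<or> j = i + 1 then - (1 / h\<^sup>2)
     else 0)"

end

(* The inverse is known in closed form (a discrete Green's function). Its column 0 dominates every
   other column entrywise in absolute value, so it has the largest absolute column sum. Its row 0
   has the largest absolute row sum: for i >= 1 the entries in the columns j >= 1 of row i add up to
   at most i / (n + theta), which is exactly the drop from entry (0, 0) to entry (i, 0). The bound on
   the 2-norm is the geometric mean of the 1-norm and the infinity-norm. *)

theory Submission
  imports Defs "HOL-Analysis.L2_Norm" "Jordan_Normal_Form.Determinant"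
begin

section \<open>Induced 1-, infinity- and 2-norms via absolute row and column sums\<close>

lemma vec_pnorm_1: "vec_pnorm 1 v = (\<Sum>i<dim_vec v. \<bar>v $ i\<bar>)"
  by (simp add: vec_pnorm_def sum_nonneg)

lemma vec_pnorm_2: "vec_pnorm 2 v = L2_set (($) v) {..<dim_vec v}"
proof -
  have "real_of_ereal 2 = 2" by (metis numeral_eq_ereal real_of_ereal.simps(1))
  then show ?thesis
    by (simp add: vec_pnorm_def L2_set_def powr_half_sqrt sum_nonneg)
qed

lemma vec_pnorm_infinity:
  "vec_pnorm \<infinity> v = Max (insert 0 ((\<lambda>i. \<bar>v $ i\<bar>) ` {..<dim_vec v}))"
  by (simp add: vec_pnorm_def)

lemma mult_mat_vec_index_sum:
  assumes "i < dim_row A" "x \<in> carrier_vec (dim_col A)"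
  shows "(A *\<^sub>v x) $ i = (\<Sum>k<dim_col A. A $$ (i, k) * x $ k)"
  using assms by (simp add: scalar_prod_def lessThan_atLeast0)

text \<open>A bound that is attained at some \<open>y\<close> of norm 1 makes the supremum a
  maximum, so each exact norm needs only an estimate and one extremal vector.\<close>

lemma mat_pnorm_eqI:
  assumes "\<And>x. x \<in> carrier_vec (dim_col A) \<Longrightarrow> vec_pnorm p (A *\<^sub>v x) \<le> c * vec_pnorm p x"
    and "\<And>x. x \<in> carrier_vec (dim_col A) \<Longrightarrow> 0 \<le> vec_pnorm p x"
    and "0 \<le> c"
    and "y \<in> carrier_vec (dim_col A)" "vec_pnorm p y = 1" "c \<le> vec_pnorm p (A *\<^sub>v y)"
  shows "mat_pnorm p A = c"
proof -
  have upper: "vec_pnorm p (A *\<^sub>v x) / vec_pnorm p x \<le> c"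
    if "x \<in> carrier_vec (dim_col A)" for x
    \<comment> \<open>If the norm of \<open>x\<close> is 0, the quotient is 0 by the convention for
      division by zero, and \<open>0 \<le> c\<close> settles the case.\<close>
    using assms(1,2)[OF that] \<open>0 \<le> c\<close> by (cases "vec_pnorm p x = 0") (auto simp: divide_le_eq)
  have "vec_pnorm p (A *\<^sub>v y) / vec_pnorm p y = c"
    using upper[OF assms(4)] assms(5,6) by simp
  with upper assms(4) show ?thesis
    unfolding mat_pnorm_def by (intro cSup_eq_maximum) force+
qed

text \<open>The triangle inequality and an interchange of sums weight each
  \<open>\<bar>x $ k\<bar>\<close> with the absolute sum of column \<open>k\<close>; the unit vector
  at the heaviest column attains the resulting bound.\<close>

lemma mat_pnorm_1_eq:
  assumes j: "j < dim_col A"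
    and max: "\<And>k. k < dim_col A \<Longrightarrow>
      (\<Sum>i<dim_row A. \<bar>A $$ (i, k)\<bar>) \<le> (\<Sum>i<dim_row A. \<bar>A $$ (i, j)\<bar>)"
  shows "mat_pnorm 1 A = (\<Sum>i<dim_row A. \<bar>A $$ (i, j)\<bar>)" (is "_ = ?c")
proof (rule mat_pnorm_eqI)
  fix x :: "real vec" assume x: "x \<in> carrier_vec (dim_col A)"
  have "vec_pnorm 1 (A *\<^sub>v x) = (\<Sum>i<dim_row A. \<bar>\<Sum>k<dim_col A. A $$ (i, k) * x $ k\<bar>)"
    using x by (simp add: vec_pnorm_1 mult_mat_vec_index_sum del: index_mult_mat_vec)
  also have "\<dots> \<le> (\<Sum>i<dim_row A. \<Sum>k<dim_col A. \<bar>A $$ (i, k)\<bar> * \<bar>x $ k\<bar>)"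
    by (intro sum_mono order.trans[OF sum_abs]) (simp add: abs_mult)
  also have "\<dots> = (\<Sum>k<dim_col A. (\<Sum>i<dim_row A. \<bar>A $$ (i, k)\<bar>) * \<bar>x $ k\<bar>)"
    unfolding sum_distrib_right by (rule sum.swap)
  also have "\<dots> \<le> (\<Sum>k<dim_col A. ?c * \<bar>x $ k\<bar>)"
    by (intro sum_mono mult_right_mono max) auto
  also have "\<dots> = ?c * vec_pnorm 1 x"
    using x by (simp add: vec_pnorm_1 sum_distrib_left)
  finally show "vec_pnorm 1 (A *\<^sub>v x) \<le> ?c * vec_pnorm 1 x" .
  show "0 \<le> vec_pnorm 1 x" by (simp add: vec_pnorm_1 sum_nonneg)
next
  show "0 \<le> ?c" by (simp add: sum_nonneg)
  show "unit_vec (dim_col A) j \<in> carrier_vec (dim_col A)" by simp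
  have "vec_pnorm 1 (unit_vec (dim_col A) j) = (\<Sum>i<dim_col A. if i = j then 1 else 0)"
    by (auto simp: vec_pnorm_1 j intro!: sum.cong)
  then show "vec_pnorm 1 (unit_vec (dim_col A) j) = 1"
    using j by simp
  show "?c \<le> vec_pnorm 1 (A *\<^sub>v unit_vec (dim_col A) j)"
    using j by (simp add: vec_pnorm_1)
qed

lemma mat_pnorm_infinity_eq:
  assumes i: "i < dim_row A"
    and col: "0 < dim_col A"
    and max: "\<And>k. k < dim_row A \<Longrightarrow>
      (\<Sum>j<dim_col A. \<bar>A $$ (k, j)\<bar>) \<le> (\<Sum>j<dim_col A. \<bar>A $$ (i, j)\<bar>)"
  shows "mat_pnorm \<infinity> A = (\<Sum>j<dim_col A. \<bar>A $$ (i, j)\<bar>)" (is "_ = ?c")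
proof (rule mat_pnorm_eqI)
  fix x :: "real vec" assume x: "x \<in> carrier_vec (dim_col A)"
  have nonneg: "0 \<le> vec_pnorm \<infinity> x"
    by (simp add: vec_pnorm_infinity)
  then show "0 \<le> vec_pnorm \<infinity> x" .
  have xk: "\<bar>x $ k\<bar> \<le> vec_pnorm \<infinity> x" if "k < dim_col A" for k
    using x that unfolding vec_pnorm_infinity by (intro Max_ge) auto
  have "\<bar>(A *\<^sub>v x) $ k\<bar> \<le> ?c * vec_pnorm \<infinity> x" if k: "k < dim_row A" for k
  proof -
    have "\<bar>(A *\<^sub>v x) $ k\<bar> = \<bar>\<Sum>j<dim_col A. A $$ (k, j) * x $ j\<bar>"
      using k x by (simp only: mult_mat_vec_index_sum)
    also have "\<dots> \<le> (\<Sum>j<dim_col A. \<bar>A $$ (k, j)\<bar> * \<bar>x $ j\<bar>)"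
      by (rule order.trans[OF sum_abs]) (simp add: abs_mult)
    also have "\<dots> \<le> (\<Sum>j<dim_col A. \<bar>A $$ (k, j)\<bar> * vec_pnorm \<infinity> x)"
      by (intro sum_mono mult_left_mono xk) auto
    also have "\<dots> = (\<Sum>j<dim_col A. \<bar>A $$ (k, j)\<bar>) * vec_pnorm \<infinity> x"
      by (simp add: sum_distrib_right)
    also have "\<dots> \<le> ?c * vec_pnorm \<infinity> x"
      by (intro mult_right_mono max k nonneg)
    finally show ?thesis .
  qed
  \<comment> \<open>The \<open>0\<close> inserted under \<open>Max\<close> has to be bounded as
    well.\<close>
  moreover have "0 \<le> ?c * vec_pnorm \<infinity> x"
    using nonneg by (simp add: sum_nonneg)
  ultimately show "vec_pnorm \<infinity> (A *\<^sub>v x) \<le> ?c * vec_pnorm \<infinity> x"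
    by (subst vec_pnorm_infinity, intro Max.boundedI)
      (auto simp del: index_mult_mat_vec)
next
  \<comment> \<open>The sign pattern of row \<open>i\<close> turns entry \<open>i\<close> of the
    product into the full absolute row sum.\<close>
  let ?y = "vec (dim_col A) (\<lambda>j. if 0 \<le> A $$ (i, j) then 1 else - 1 :: real)"
  show "0 \<le> ?c" by (simp add: sum_nonneg)
  show y: "?y \<in> carrier_vec (dim_col A)" by simp
  \<comment> \<open>Here \<open>0 < dim_col A\<close> enters: the norm of the empty vector would be
    0, not 1.\<close>
  have "(\<lambda>j. \<bar>?y $ j\<bar>) ` {..<dim_vec ?y} = {1}"
    using col by (auto simp: image_iff)
  then show "vec_pnorm \<infinity> ?y = 1"
    by (simp add: vec_pnorm_infinity)
  have "(A *\<^sub>v ?y) $ i = (\<Sum>j<dim_col A. A $$ (i, j) * ?y $ j)"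
    using i by (simp only: mult_mat_vec_index_sum y)
  also have "\<dots> = ?c" by (intro sum.cong) auto
  finally have "?c \<le> \<bar>(A *\<^sub>v ?y) $ i\<bar>" by simp
  also have "\<dots> \<le> vec_pnorm \<infinity> (A *\<^sub>v ?y)"
    unfolding vec_pnorm_infinity using i by (intro Max_ge) auto
  finally show "?c \<le> vec_pnorm \<infinity> (A *\<^sub>v ?y)" .
qed

text \<open>Schur's test: Cauchy--Schwarz is applied to \<open>\<bar>a\<bar> * \<bar>x\<bar> = sqrt \<bar>a\<bar> * (sqrt \<bar>a\<bar> * \<bar>x\<bar>)\<close>.\<close>

lemma mat_pnorm_2_le:
  assumes R: "\<And>i. i < dim_row A \<Longrightarrow> (\<Sum>j<dim_col A. \<bar>A $$ (i, j)\<bar>) \<le> R"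
    and C: "\<And>j. j < dim_col A \<Longrightarrow> (\<Sum>i<dim_row A. \<bar>A $$ (i, j)\<bar>) \<le> C"
    and "0 \<le> R" "0 \<le> C"
  shows "mat_pnorm 2 A \<le> sqrt (R * C)"
  unfolding mat_pnorm_def
proof (rule cSUP_least)
  show "carrier_vec (dim_col A) \<noteq> ({} :: real vec set)"
    using zero_carrier_vec by blast
  fix x :: "real vec" assume x: "x \<in> carrier_vec (dim_col A)"
  have row: "((A *\<^sub>v x) $ i)\<^sup>2 \<le> R * (\<Sum>j<dim_col A. \<bar>A $$ (i, j)\<bar> * (x $ j)\<^sup>2)"
    if i: "i < dim_row A" for i
  proof -
    let ?a = "\<lambda>j. sqrt \<bar>A $$ (i, j)\<bar>"
    have "\<bar>(A *\<^sub>v x) $ i\<bar> = \<bar>\<Sum>j<dim_col A. A $$ (i, j) * x $ j\<bar>"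
      using i x by (simp only: mult_mat_vec_index_sum)
    also have "\<dots> \<le> (\<Sum>j<dim_col A. \<bar>?a j\<bar> * \<bar>?a j * x $ j\<bar>)"
      by (rule order.trans[OF sum_abs]) (simp add: abs_mult flip: mult.assoc)
    also have "\<dots> \<le> L2_set ?a {..<dim_col A} * L2_set (\<lambda>j. ?a j * x $ j) {..<dim_col A}"
      by (rule L2_set_mult_ineq)
    finally have "((A *\<^sub>v x) $ i)\<^sup>2
        \<le> (L2_set ?a {..<dim_col A} * L2_set (\<lambda>j. ?a j * x $ j) {..<dim_col A})\<^sup>2"
      by (metis abs_ge_zero power2_abs power_mono)
    also have "\<dots> = (\<Sum>j<dim_col A. \<bar>A $$ (i, j)\<bar>) * (\<Sum>j<dim_col A. \<bar>A $$ (i, j)\<bar> * (x $ j)\<^sup>2)"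
      by (simp add: power_mult_distrib L2_set_def sum_nonneg)
    also have "\<dots> \<le> R * (\<Sum>j<dim_col A. \<bar>A $$ (i, j)\<bar> * (x $ j)\<^sup>2)"
      by (intro mult_right_mono R i sum_nonneg) auto
    finally show ?thesis .
  qed
  have "(\<Sum>i<dim_row A. ((A *\<^sub>v x) $ i)\<^sup>2)
      \<le> (\<Sum>i<dim_row A. R * (\<Sum>j<dim_col A. \<bar>A $$ (i, j)\<bar> * (x $ j)\<^sup>2))"
    by (intro sum_mono row) auto
  \<comment> \<open>After the interchange of sums, the weight of each \<open>(x $ j)\<^sup>2\<close>
    is a column sum, which \<open>C\<close> bounds.\<close>
  also have "\<dots> = R * (\<Sum>j<dim_col A. (\<Sum>i<dim_row A. \<bar>A $$ (i, j)\<bar>) * (x $ j)\<^sup>2)"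
    unfolding sum_distrib_right by (subst sum.swap) (simp add: sum_distrib_left)
  also have "\<dots> \<le> R * (\<Sum>j<dim_col A. C * (x $ j)\<^sup>2)"
    by (intro mult_left_mono sum_mono mult_right_mono C \<open>0 \<le> R\<close>) auto
  finally have "(\<Sum>i<dim_row A. ((A *\<^sub>v x) $ i)\<^sup>2) \<le> R * C * (\<Sum>j<dim_col A. (x $ j)\<^sup>2)"
    by (simp add: sum_distrib_left mult.assoc)
  then have "vec_pnorm 2 (A *\<^sub>v x) \<le> sqrt (R * C) * vec_pnorm 2 x"
    using x unfolding vec_pnorm_2 L2_set_def real_sqrt_mult[symmetric]
    by (simp del: index_mult_mat_vec)
  moreover have "0 \<le> vec_pnorm 2 x" unfolding vec_pnorm_2 by (rule L2_set_nonneg)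
  ultimately show "vec_pnorm 2 (A *\<^sub>v x) / vec_pnorm 2 x \<le> sqrt (R * C)"
    using \<open>0 \<le> R\<close> \<open>0 \<le> C\<close> by (cases "vec_pnorm 2 x = 0") (auto simp: divide_le_eq)
qed

section \<open>The closed form of the inverse and its verification\<close>

lemma mat_inverse_eq_SomeI:
  fixes A B :: "'a :: field mat"
  assumes A: "A \<in> carrier_mat n n" and B: "B \<in> carrier_mat n n" and AB: "A * B = 1\<^sub>m n"
  shows "mat_inverse A = Some B"
proof -
  have BA: "B * A = 1\<^sub>m n" by (rule mat_mult_left_right_inverse[OF A B AB])
  \<comment> \<open>Being a unit excludes the result \<open>None\<close>. Whatever \<open>C\<close>
    is returned then equals \<open>B\<close>, since
    \<open>B = B * (A * C) = (B * A) * C = C\<close>.\<close>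
  have "A \<in> Units (ring_mat TYPE('a) n ())"
    using A B AB BA unfolding Units_def by (auto simp: ring_mat_simps)
  then obtain C where C: "mat_inverse A = Some C"
    using mat_inverse(1)[OF A, of "()"] by (cases "mat_inverse A") auto
  from mat_inverse(2)[OF A C] have "A * C = 1\<^sub>m n" "C \<in> carrier_mat n n" by auto
  then have "B * (A * C) = B" "B * A * C = C"
    using B BA by simp_all
  with C show ?thesis
    using assoc_mult_mat[OF B A \<open>C \<in> carrier_mat n n\<close>] by simp
qed

text \<open>Column \<open>0\<close> is the linear grid function vanishing at node \<open>n + 1\<close> on which
  the ghost-point row (interpolation at the left end point) takes the value \<open>1\<close>.
  The other columns are the discrete Green's function with homogeneous boundary conditions: to the
  left of node \<open>j\<close> it is proportional to \<open>i - 1 + \<theta>\<close>, the linear function killed by the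
  ghost-point row.\<close>

definition coco_russo_inv :: "nat \<Rightarrow> real \<Rightarrow> nat \<Rightarrow> nat \<Rightarrow> real" where
  "coco_russo_inv n \<theta> i j = (let N = real n + 1 in
     if j = 0 then (N - real i) / (N - 1 + \<theta>)
     else (real (min i j) - 1 + \<theta>) * (N - real (max i j)) / (N\<^sup>2 * (N - 1 + \<theta>)))"

lemma coco_russo_row_0:
  assumes "n \<ge> 1"
  shows "(\<Sum>k<n + 1. coco_russo n h \<theta> $$ (0, k) * g k) = \<theta> * g 0 + (1 - \<theta>) * g 1"
proof -
  have "(\<Sum>k<n + 1. coco_russo n h \<theta> $$ (0, k) * g k)
      = (\<Sum>k<n + 1. (if k = 0 then \<theta> * g 0 else 0) + (if k = 1 then (1 - \<theta>) * g 1 else 0))"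
    by (intro sum.cong) (auto simp: coco_russo_def)
  then show ?thesis using assms by (simp only: sum.distrib sum.delta finite_lessThan) simp
qed

text \<open>The last row has no entry to the right of the diagonal. The Dirichlet value
  \<open>g (n + 1) = 0\<close> lets it share the three-point formula of the other rows.\<close>

lemma coco_russo_row_Suc:
  assumes "Suc i \<le> n" "g (n + 1) = 0"
  shows "(\<Sum>k<n + 1. coco_russo n h \<theta> $$ (Suc i, k) * g k)
    = (2 * g (Suc i) - g i - g (i + 2)) / h\<^sup>2"
proof -
  have "(\<Sum>k<n + 1. coco_russo n h \<theta> $$ (Suc i, k) * g k)
      = (\<Sum>k<n + 1. (if k = Suc i then 2 * g (Suc i) / h\<^sup>2 else 0)
          - (if k = i then g i / h\<^sup>2 else 0) - (if k = i + 2 then g (i + 2) / h\<^sup>2 else 0))"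
    using assms(1) by (intro sum.cong) (auto simp: coco_russo_def)
  also have "\<dots> = 2 * g (Suc i) / h\<^sup>2 - g i / h\<^sup>2 - g (i + 2) / h\<^sup>2"
  proof (cases "i + 2 = n + 1")
    case True
    with assms show ?thesis
      by (simp only: sum_subtractf sum.delta finite_lessThan) simp
  next
    case False
    with assms show ?thesis
      by (simp only: sum_subtractf sum.delta finite_lessThan) simp
  qed
  finally show ?thesis by (simp add: diff_divide_distrib)
qed

lemma coco_russo_mult_inv:
  assumes "n \<ge> 1" "h = 1 / (real n + 1)" "0 < \<theta>" "i \<le> n" "j \<le> n"
  shows "(\<Sum>k<n + 1. coco_russo n h \<theta> $$ (i, k) * coco_russo_inv n \<theta> k j) = (if i = j then 1 else 0)"
proof -
  have D: "real n + \<theta> > 0" using assms by linarith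
  \<comment> \<open>The formula for the inverse extends to node \<open>n + 1\<close>, one past the
    last row, where it takes the Dirichlet value required by
    \<open>coco_russo_row_Suc\<close>.\<close>
  have vanish: "coco_russo_inv n \<theta> (n + 1) j = 0"
    using assms(5) by (simp add: coco_russo_inv_def Let_def)
  show ?thesis
  proof (cases i)
    case 0
    show ?thesis
    proof (cases "j = 0")
      case True
      then have "coco_russo_inv n \<theta> k j = (real n + 1 - real k) / (real n + \<theta>)" for k
        by (simp add: coco_russo_inv_def)
      then have "\<theta> * coco_russo_inv n \<theta> 0 j + (1 - \<theta>) * coco_russo_inv n \<theta> 1 j
          = (\<theta> * (real n + 1) + (1 - \<theta>) * real n) / (real n + \<theta>)"
        by (simp add: add_divide_distrib distrib_left)
      also have "\<theta> * (real n + 1) + (1 - \<theta>) * real n = real n + \<theta>"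
        by (simp add: algebra_simps)
      finally show ?thesis unfolding 0 coco_russo_row_0[OF assms(1)] using D True by simp
    next
      case False
      \<comment> \<open>Rows 0 and 1 both have \<open>max k j = j\<close>, so they share the factor
        \<open>c\<close>. The remaining factors \<open>\<theta> - 1\<close> and
        \<open>\<theta>\<close> cancel under the weights \<open>\<theta>\<close> and
        \<open>1 - \<theta>\<close>.\<close>
      define c where "c = (real n + 1 - real j) / ((real n + 1)\<^sup>2 * (real n + \<theta>))"
      have "min (Suc 0) j = 1" "max (Suc 0) j = j" using False by auto
      then have val: "coco_russo_inv n \<theta> 0 j = (\<theta> - 1) * c" "coco_russo_inv n \<theta> 1 j = \<theta> * c"
        using False by (simp_all add: coco_russo_inv_def c_def Let_def)
      show ?thesis unfolding 0 coco_russo_row_0[OF assms(1)] val using False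
        by (simp add: algebra_simps)
    qed
  next
    case (Suc l)
    have h2: "h\<^sup>2 = 1 / (real n + 1)\<^sup>2" using assms(2) by (simp add: power_divide)
    have N: "(real n + 1)\<^sup>2 > 0" by simp
    have eq: "(\<Sum>k<n + 1. coco_russo n h \<theta> $$ (i, k) * coco_russo_inv n \<theta> k j)
      = (2 * coco_russo_inv n \<theta> (Suc l) j - coco_russo_inv n \<theta> l j
          - coco_russo_inv n \<theta> (l + 2) j) * (real n + 1)\<^sup>2"
      unfolding Suc using coco_russo_row_Suc[of l n "\<lambda>k. coco_russo_inv n \<theta> k j"] assms(4) vanish Suc
      by (simp add: h2)
    show ?thesis
    proof (cases "j = 0")
      case True
      \<comment> \<open>Column 0 is linear in \<open>k\<close>, so its second differences
        vanish.\<close>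
      then have "coco_russo_inv n \<theta> k j = (real n + 1 - real k) / (real n + \<theta>)" for k
        by (simp add: coco_russo_inv_def)
      then show ?thesis unfolding eq using True Suc
        by (simp add: algebra_simps flip: diff_divide_distrib add_divide_distrib)
    next
      case False
      let ?M = "\<lambda>k. (real (min k j) - 1 + \<theta>) * (real n + 1 - real (max k j))"
      have "coco_russo_inv n \<theta> k j * (real n + 1)\<^sup>2 = ?M k / (real n + \<theta>)" for k
        using False N by (simp add: coco_russo_inv_def Let_def)
      then have "(\<Sum>k<n + 1. coco_russo n h \<theta> $$ (i, k) * coco_russo_inv n \<theta> k j)
          = (2 * ?M (Suc l) - ?M l - ?M (l + 2)) / (real n + \<theta>)"
        unfolding eq by (simp add: left_diff_distrib diff_divide_distrib mult.assoc)
      also have "2 * ?M (Suc l) - ?M l - ?M (l + 2) = (if i = j then real n + \<theta> else 0)"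
      proof -
        \<comment> \<open>\<open>?M\<close> is linear on either side of its kink at
          \<open>j\<close>. There the slope falls from \<open>real n + 1 - real j\<close> to
          \<open>- (real j - 1 + \<theta>)\<close>, a drop of
          \<open>real n + \<theta>\<close>.\<close>
        consider "j \<le> l" | "j = Suc l" | "l + 2 \<le> j" by linarith
        then show ?thesis
          by cases (auto simp: Suc min_def max_def algebra_simps)
      qed
      finally show ?thesis using D by simp
    qed
  qed
qed

section \<open>Absolute row and column sums of the inverse\<close>

lemma sum_reverse_gauss: "(\<Sum>k<n. real n - real k) = real n * (real n + 1) / 2"
  by (induction n) (simp_all add: sum.distrib sum_subtractf field_simps)

text \<open>With \<open>N = n + 1\<close>, the first factor of the Green's function is at most
  \<open>N\<close> in absolute value (in row 0 it is \<open>\<theta> - 1\<close>, hence negative),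
  and the second is at most \<open>N - i\<close>. The prefactor \<open>1 / N\<^sup>2\<close> more
  than absorbs the \<open>N\<close>.\<close>

lemma abs_coco_russo_inv_le_col_0:
  assumes "0 < \<theta>" "\<theta> < 1" "i \<le> n" "j \<le> n"
  shows "\<bar>coco_russo_inv n \<theta> i j\<bar> \<le> coco_russo_inv n \<theta> i 0"
proof (cases "j = 0")
  case True
  then show ?thesis using assms by (simp add: coco_russo_inv_def)
next
  case False
  then have D: "real n + \<theta> > 0" using assms by linarith
  have m: "\<bar>real (min i j) - 1 + \<theta>\<bar> \<le> real n + 1"
    using assms by (auto simp: abs_le_iff min_def)
  have "\<bar>real (min i j) - 1 + \<theta>\<bar> * (real n + 1 - real (max i j))
      \<le> (real n + 1) * (real n + 1 - real i)"
    using assms by (intro mult_mono m) auto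
  also have "\<dots> \<le> (real n + 1)\<^sup>2 * (real n + 1 - real i)"
    using assms by (intro mult_right_mono) (auto simp: power2_eq_square algebra_simps)
  finally have "\<bar>real (min i j) - 1 + \<theta>\<bar> * (real n + 1 - real (max i j))
        / ((real n + 1)\<^sup>2 * (real n + \<theta>))
      \<le> (real n + 1)\<^sup>2 * (real n + 1 - real i) / ((real n + 1)\<^sup>2 * (real n + \<theta>))"
    using D by (intro divide_right_mono) auto
  then show ?thesis
    using False D assms by (simp add: coco_russo_inv_def Let_def abs_mult del: of_nat_max of_nat_min)
qed

text \<open>Trading the minimum and maximum for a product that is linear in \<open>j\<close> makes
  the row sums computable by \<open>sum_reverse_gauss\<close>.\<close>

lemma abs_coco_russo_inv_le:
  assumes "0 < \<theta>" "\<theta> < 1" "1 \<le> i" "i \<le> n" "1 \<le> j" "j \<le> n"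
  shows "\<bar>coco_russo_inv n \<theta> i j\<bar>
    \<le> real i * (real n + 1 - real j) / ((real n + 1)\<^sup>2 * (real n + \<theta>))"
proof -
  have m: "0 \<le> real (min i j) - 1 + \<theta>" "real (min i j) - 1 + \<theta> \<le> real i"
    using assms by (auto simp: min_def)
  have "(real (min i j) - 1 + \<theta>) * (real n + 1 - real (max i j)) \<le> real i * (real n + 1 - real j)"
    using assms m by (intro mult_mono) auto
  then have "(real (min i j) - 1 + \<theta>) * (real n + 1 - real (max i j)) / ((real n + 1)\<^sup>2 * (real n + \<theta>))
      \<le> real i * (real n + 1 - real j) / ((real n + 1)\<^sup>2 * (real n + \<theta>))"
    using assms by (intro divide_right_mono) auto
  then show ?thesis
    using assms m by (simp add: coco_russo_inv_def Let_def abs_mult del: of_nat_max of_nat_min)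
qed

lemma sum_coco_russo_inv_col_0:
  assumes "0 < \<theta>" "\<theta> < 1"
  shows "(\<Sum>i<n + 1. \<bar>coco_russo_inv n \<theta> i 0\<bar>)
    = (real n + 1) * (real n + 2) / (2 * (real n + \<theta>))"
proof -
  have "(\<Sum>i<n + 1. \<bar>coco_russo_inv n \<theta> i 0\<bar>)
      = (\<Sum>i<n + 1. real (n + 1) - real i) / (real n + \<theta>)"
    unfolding sum_divide_distrib using assms
    by (intro sum.cong) (auto simp: coco_russo_inv_def add.commute)
  then show ?thesis
    by (simp only: sum_reverse_gauss) (simp add: algebra_simps)
qed

lemma sum_coco_russo_inv_row_0:
  assumes "0 < \<theta>" "\<theta> < 1"
  shows "(\<Sum>j<n + 1. \<bar>coco_russo_inv n \<theta> 0 j\<bar>)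
    = (real n + 1 + (1 - \<theta>) * real n / (2 * (real n + 1))) / (real n + \<theta>)"
proof -
  have D: "real n + \<theta> > 0" using assms by linarith
  \<comment> \<open>In row 0 the minimum is 0, so these entries carry the negative factor
    \<open>\<theta> - 1\<close>, whose absolute value is \<open>1 - \<theta>\<close>.\<close>
  have "(\<Sum>j<n. \<bar>coco_russo_inv n \<theta> 0 (Suc j)\<bar>)
      = (\<Sum>j<n. (1 - \<theta>) / ((real n + 1)\<^sup>2 * (real n + \<theta>)) * (real n - real j))"
    using assms D
    by (intro sum.cong) (auto simp: coco_russo_inv_def Let_def abs_mult)
  also have "\<dots> = (1 - \<theta>) / ((real n + 1)\<^sup>2 * (real n + \<theta>)) * (real n * (real n + 1) / 2)"
    by (simp only: sum_distrib_left[symmetric] sum_reverse_gauss)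
  also have "\<dots> = (1 - \<theta>) * real n / (2 * (real n + 1)) / (real n + \<theta>)"
    by (simp add: power2_eq_square)
  finally show ?thesis
    using D by (simp only: Suc_eq_plus1[symmetric] sum.lessThan_Suc_shift)
      (simp add: coco_russo_inv_def add_divide_distrib)
qed

lemma sum_coco_russo_inv_row_le:
  assumes "0 < \<theta>" "\<theta> < 1" "i \<le> n"
  shows "(\<Sum>j<n + 1. \<bar>coco_russo_inv n \<theta> i j\<bar>) \<le> (\<Sum>j<n + 1. \<bar>coco_russo_inv n \<theta> 0 j\<bar>)"
proof (cases "i = 0")
  case False
  have D: "real n + \<theta> > 0" using assms by linarith
  have "(\<Sum>j<n. \<bar>coco_russo_inv n \<theta> i (Suc j)\<bar>)
      \<le> (\<Sum>j<n. real i / ((real n + 1)\<^sup>2 * (real n + \<theta>)) * (real n - real j))"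
    using abs_coco_russo_inv_le[OF assms(1,2) _ assms(3), of "Suc _"] False
    by (intro sum_mono) auto
  also have "\<dots> = real i / ((real n + 1)\<^sup>2 * (real n + \<theta>)) * (real n * (real n + 1) / 2)"
    by (simp only: sum_distrib_left[symmetric] sum_reverse_gauss)
  also have "\<dots> = (real i * (real n / (real n + 1)) / 2) / (real n + \<theta>)"
    by (simp add: power2_eq_square)
  \<comment> \<open>The discarded factor \<open>real n / (real n + 1) / 2\<close> is less than
    1.\<close>
  also have "\<dots> \<le> real i / (real n + \<theta>)"
    using D by (intro divide_right_mono) (auto simp: field_simps)
  finally have tail: "(\<Sum>j<n. \<bar>coco_russo_inv n \<theta> i (Suc j)\<bar>) \<le> real i / (real n + \<theta>)" .
  have "\<bar>coco_russo_inv n \<theta> i 0\<bar> = (real n + 1) / (real n + \<theta>) - real i / (real n + \<theta>)"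
    using D assms(3) by (simp add: coco_russo_inv_def flip: diff_divide_distrib)
  with tail have "(\<Sum>j<n + 1. \<bar>coco_russo_inv n \<theta> i j\<bar>) \<le> (real n + 1) / (real n + \<theta>)"
    by (simp only: Suc_eq_plus1[symmetric] sum.lessThan_Suc_shift)
  \<comment> \<open>The first entry of row 0 alone already reaches the bound.\<close>
  also have "\<dots> = \<bar>coco_russo_inv n \<theta> 0 0\<bar>"
    using D by (simp add: coco_russo_inv_def)
  also have "\<dots> \<le> (\<Sum>j<n + 1. \<bar>coco_russo_inv n \<theta> 0 j\<bar>)"
    by (intro member_le_sum) auto
  finally show ?thesis .
qed simp

section \<open>The norms of the inverse in terms of \<open>h\<close> and
  \<open>\<theta>\<close>\<close>

theorem mainTheorem2:
  fixes n :: nat and h \<theta> :: real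
  assumes "n \<ge> 1"
    and "h = 1 / (real n + 1)"
    and "0 < \<theta>" and "\<theta> < 1"
  shows "\<exists>B. mat_inverse (coco_russo n h \<theta>) = Some B \<and>
     mat_pnorm 1 B = (h + 1) / (2 * h * (h * (\<theta> - 1) + 1)) \<and>
     mat_pnorm \<infinity> B = (2 - h * (\<theta> - 1) * (1 - h)) / (2 * (h * (\<theta> - 1) + 1)) \<and>
     mat_pnorm 2 B \<le> 1 / (2 * (h * (\<theta> - 1) + 1)) * sqrt (2 / h + 2 + (h\<^sup>2 - 1) * (\<theta> - 1))"
proof -
  define B where "B = mat (n + 1) (n + 1) (\<lambda>(i, j). coco_russo_inv n \<theta> i j)"
  have B [simp]: "dim_row B = n + 1" "dim_col B = n + 1" by (simp_all add: B_def)
  have B_index: "B $$ (i, j) = coco_russo_inv n \<theta> i j" if "i < n + 1" "j < n + 1" for i j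
    using that by (simp add: B_def)
  have A: "coco_russo n h \<theta> \<in> carrier_mat (n + 1) (n + 1)" by (simp add: coco_russo_def)
  have "coco_russo n h \<theta> * B = 1\<^sub>m (n + 1)"
  proof (rule eq_matI)
    fix i j assume "i < dim_row (1\<^sub>m (n + 1))" "j < dim_col (1\<^sub>m (n + 1))"
    then have ij: "i < n + 1" "j < n + 1" by simp_all
    then have "(coco_russo n h \<theta> * B) $$ (i, j)
        = (\<Sum>k<n + 1. coco_russo n h \<theta> $$ (i, k) * coco_russo_inv n \<theta> k j)"
      using A by (simp add: scalar_prod_def B_index lessThan_atLeast0)
    also have "\<dots> = (1\<^sub>m (n + 1)) $$ (i, j)"
      using coco_russo_mult_inv[OF assms(1-3)] ij by simp
    finally show "(coco_russo n h \<theta> * B) $$ (i, j) = (1\<^sub>m (n + 1)) $$ (i, j)" .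
  qed (use A in auto)
  then have inv: "mat_inverse (coco_russo n h \<theta>) = Some B"
    using A by (intro mat_inverse_eq_SomeI) (auto intro: carrier_matI)
  let ?C = "(real n + 1) * (real n + 2) / (2 * (real n + \<theta>))"
  let ?R = "(real n + 1 + (1 - \<theta>) * real n / (2 * (real n + 1))) / (real n + \<theta>)"
  let ?D = "h * (\<theta> - 1) + 1"
  have "real n + \<theta> > 0" using assms by linarith
  have D: "real n + \<theta> = ?D / h" and n: "real n = (1 - h) / h" and "h > 0"
    by (simp_all add: assms(2) divide_simps)
  then have "?D > 0" using \<open>real n + \<theta> > 0\<close> by (simp add: zero_less_divide_iff)
  \<comment> \<open>\<open>D\<close> is unfolded before \<open>n\<close>, so that
    \<open>real n + \<theta>\<close> is still intact and becomes \<open>?D / h\<close> as a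
    whole.\<close>
  have C: "?C = (h + 1) / (2 * h * ?D)"
    unfolding D unfolding n using \<open>h > 0\<close> \<open>?D > 0\<close> by (simp add: divide_simps)
  have R: "?R = (2 - h * (\<theta> - 1) * (1 - h)) / (2 * ?D)"
    unfolding D unfolding n using \<open>h > 0\<close> \<open>?D > 0\<close>
    by (simp add: divide_simps) (simp add: algebra_simps)
  have col_0: "(\<Sum>i<n + 1. \<bar>B $$ (i, 0)\<bar>) = ?C"
    using sum_coco_russo_inv_col_0[OF assms(3,4), of n] by (simp add: B_index del: sum.lessThan_Suc)
  have row_0: "(\<Sum>j<n + 1. \<bar>B $$ (0, j)\<bar>) = ?R"
    using sum_coco_russo_inv_row_0[OF assms(3,4), of n] by (simp add: B_index del: sum.lessThan_Suc)
  have col: "(\<Sum>i<n + 1. \<bar>B $$ (i, j)\<bar>) \<le> (\<Sum>i<n + 1. \<bar>B $$ (i, 0)\<bar>)" if "j < n + 1" for j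
  proof (intro sum_mono)
    fix i assume "i \<in> {..<n + 1}"
    then have "\<bar>B $$ (i, j)\<bar> \<le> B $$ (i, 0)"
      using that abs_coco_russo_inv_le_col_0[OF assms(3,4), of i n j] by (simp add: B_index)
    then show "\<bar>B $$ (i, j)\<bar> \<le> \<bar>B $$ (i, 0)\<bar>" by linarith
  qed
  have row: "(\<Sum>j<n + 1. \<bar>B $$ (i, j)\<bar>) \<le> (\<Sum>j<n + 1. \<bar>B $$ (0, j)\<bar>)" if "i < n + 1" for i
    using that sum_coco_russo_inv_row_le[OF assms(3,4), of i n]
    by (simp add: B_index del: sum.lessThan_Suc)
  have "mat_pnorm 1 B = ?C"
    using mat_pnorm_1_eq[of 0 B] col col_0 by (simp del: sum.lessThan_Suc)
  moreover have "mat_pnorm \<infinity> B = ?R"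
    using mat_pnorm_infinity_eq[of 0 B] row row_0 by (simp del: sum.lessThan_Suc)
  moreover have "mat_pnorm 2 B \<le> sqrt (?R * ?C)"
  proof (rule mat_pnorm_2_le)
    show "0 \<le> ?C" using col_0 by (metis sum_nonneg abs_ge_zero)
    show "0 \<le> ?R" using row_0 by (metis sum_nonneg abs_ge_zero)
  qed (use row row_0 col col_0 in \<open>simp_all del: sum.lessThan_Suc\<close>)
  moreover have "sqrt (?R * ?C) = 1 / (2 * ?D) * sqrt (2 / h + 2 + (h\<^sup>2 - 1) * (\<theta> - 1))"
  proof -
    \<comment> \<open>The numerators multiply to
      \<open>(h + 1) * (2 - h * (\<theta> - 1) * (1 - h))\<close>; dividing by \<open>h\<close> and
      using \<open>(1 - h) * (1 + h) = 1 - h\<^sup>2\<close> gives the radicand.\<close>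
    have "?R * ?C = (2 / h + 2 + (h\<^sup>2 - 1) * (\<theta> - 1)) / (2 * ?D)\<^sup>2"
      unfolding C R using \<open>h > 0\<close> \<open>?D > 0\<close>
      by (simp add: divide_simps) (simp add: algebra_simps power2_eq_square)
    then show ?thesis
      using \<open>?D > 0\<close> by (simp only: real_sqrt_divide real_sqrt_abs) simp
  qed
  ultimately show ?thesis using inv C R by auto
qed

end
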